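(* Let $n\ge 3$ and $1\le r\le n-2$ be integers, and let $K_n$ be the complete graph on $n$ vertices. If $n$ is even, or $n$ is odd and $r=\frac{n-1}{2}$, then \[ cms_r(K_n)=\left\lfloor \frac{rn-1}{2}\right\rfloor. \]
   Context: All graphs are simple. For an integer $N$, $[N]=\{0,1,\dots,N-1\}$. An ordering of a graph $G=(V,E)$ is a bijection $\ell:E\to[|E|]$; edges are cyclically consecutive in $\ell$ if their labels are consecutive integers modulo $|E|$. A graph is $(\le r)$-regular if every vertex has degree at most $r$. For an ordering $\ell$ of $G$, $cms_r(\ell)$ is the largest integer $s$ such that every $s$ cyclically consecutive edges of $\ell$ form a $(\le r)$-regular subgraph of $G$; $cms_r(G)$ is the maximum of $cms_r(\ell)$ over all orderings $\ell$ of $G$. *)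

theory Defs
  imports Complex_Main "HOL-Library.Ramsey"
begin

text \<open>A graph is a pair of a vertex set and an edge set; \<open>[V]\<^bsup>2\<^esup>\<close> is the set of 2-element
  subsets of \<open>V\<close>.\<close>

type_synonym 'a graph = "'a set \<times> 'a set set"

abbreviation verts :: "'a graph \<Rightarrow> 'a set" where
  "verts G \<equiv> fst G"

abbreviation edges :: "'a graph \<Rightarrow> 'a set set" where
  "edges G \<equiv> snd G"

definition simple_graph :: "'a graph \<Rightarrow> bool" where
  "simple_graph G \<longleftrightarrow> finite (verts G) \<and> edges G \<subseteq> [verts G]\<^bsup>2\<^esup>"

definition complete_graph :: "nat \<Rightarrow> nat graph" where
  "complete_graph n = ({..<n}, [{..<n}]\<^bsup>2\<^esup>)"

definition degree :: "'a graph \<Rightarrow> 'a \<Rightarrow> nat" where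
  "degree G v = card {e \<in> edges G. v \<in> e}"

definition le_regular :: "nat \<Rightarrow> 'a graph \<Rightarrow> bool" where
  "le_regular r G \<longleftrightarrow> (\<forall>v \<in> verts G. degree G v \<le> r)"

definition edge_ordering :: "'a graph \<Rightarrow> ('a set \<Rightarrow> nat) \<Rightarrow> bool" where
  "edge_ordering G l \<longleftrightarrow> bij_betw l (edges G) {..<card (edges G)}"

text \<open>The \<open>s\<close> cyclically consecutive edges whose first label is \<open>i\<close>; these are \<open>s\<close> distinct
  edges only for \<open>s \<le> card (edges G)\<close>, which is why \<open>cms_ord\<close> restricts \<open>s\<close> to this range.\<close>

definition cyclic_window :: "'a graph \<Rightarrow> ('a set \<Rightarrow> nat) \<Rightarrow> nat \<Rightarrow> nat \<Rightarrow> 'a set set" where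
  "cyclic_window G l s i = {e \<in> edges G. \<exists>j<s. l e = (i + j) mod card (edges G)}"

definition cms_ord :: "nat \<Rightarrow> 'a graph \<Rightarrow> ('a set \<Rightarrow> nat) \<Rightarrow> nat" where
  "cms_ord r G l = Max {s. s \<le> card (edges G) \<and>
     (\<forall>i < card (edges G). le_regular r (verts G, cyclic_window G l s i))}"

definition cms :: "nat \<Rightarrow> 'a graph \<Rightarrow> nat" where
  "cms r G = Max {cms_ord r G l | l. edge_ordering G l}"

lemma simple_graph_complete_graph: "simple_graph (complete_graph n)"
  by (simp add: simple_graph_def complete_graph_def)

text \<open>Both maxima range over finite nonempty sets.\<close>

lemma cms_ord_set:
  defines "S \<equiv> \<lambda>r G l. {s. s \<le> card (edges G) \<and>
     (\<forall>i < card (edges G). le_regular r (verts G, cyclic_window G l s i))}"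
  shows "finite (S r G l)" "0 \<in> S r G l"
  by (simp_all add: S_def le_regular_def degree_def cyclic_window_def)

lemma cms_ord_le: "cms_ord r G l \<le> card (edges G)"
proof -
  have "cms_ord r G l \<in> {s. s \<le> card (edges G) \<and>
     (\<forall>i < card (edges G). le_regular r (verts G, cyclic_window G l s i))}"
    unfolding cms_ord_def using cms_ord_set[of G r l] by (intro Max_in) blast+
  then show ?thesis by simp
qed

lemma cms_set:
  assumes "simple_graph G"
  shows "finite {cms_ord r G l | l. edge_ordering G l}"
    and "{cms_ord r G l | l. edge_ordering G l} \<noteq> {}"
proof -
  show "finite {cms_ord r G l | l. edge_ordering G l}"
    by (rule finite_subset[of _ "{..card (edges G)}"]) (auto simp: cms_ord_le)
  have "finite (edges G)"
    using assms finite_imp_finite_nsets finite_subset unfolding simple_graph_def by blast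
  then obtain l where "edge_ordering G l"
    unfolding edge_ordering_def
    using ex_bij_betw_finite_nat[of "edges G"] by (auto simp: atLeast0LessThan)
  then show "{cms_ord r G l | l. edge_ordering G l} \<noteq> {}" by blast
qed

end

theory Submission
  imports "Graph_Theory.Euler" "HOL-Number_Theory.Cong" Defs
begin

text \<open>Upper bound: a window of \<open>s\<close> edges has degree sum \<open>2s\<close>, so \<open>2s \<le> rn\<close>. If \<open>2s = rn\<close>, all
  windows are \<open>r\<close>-regular, so comparing two neighbouring windows shows that the edges with labels
  \<open>0\<close> and \<open>s\<close> coincide.

  Lower bound, \<open>n = 2m\<close>: list the edges in \<open>n - 1\<close> consecutive perfect matchings of \<open>m\<close> edges. All
  windows of \<open>rm - 1\<close> edges have degrees at most \<open>r\<close> if, passing from a matching to the \<open>r\<close>-th next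
  one, the position of no vertex inside its matching drops by more than 1. Let \<open>g = gcd r (n - 1)\<close>
  and \<open>n - 1 = gL\<close>. Besides a vertex at infinity, take \<open>g\<close> groups of \<open>L\<close> vertices. A near-1-factorization
  of \<open>K\<^sub>g\<close> splits \<open>K\<^sub>n\<close> into \<open>g\<close> spanning \<open>L\<close>-regular graphs, each consisting of one \<open>K\<^sub>L\<^sub>+\<^sub>1\<close> (a group and
  infinity) and several \<open>K\<^sub>L\<^sub>,\<^sub>L\<close>. Both have cyclic 1-factorizations in which positions drop by at most 1
  from one factor to the next, and stepping by \<open>r\<close> traverses these \<open>L\<close> factors cyclically.

  Lower bound, \<open>n = 2r + 1\<close>: place the edges of an Euler circuit so that edges adjacent in the circuit
  never share a window of length \<open>\<lfloor>(rn - 1) / 2\<rfloor>\<close>. The circuit visits each vertex \<open>r\<close> times, and each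
  visit contributes at most one edge to a window.\<close>

section \<open>Windows and the upper bound\<close>

lemma card_edges_complete_graph: "card (edges (complete_graph n)) = n choose 2"
  by (simp add: complete_graph_def)

lemma finite_edges_complete_graph: "finite (edges (complete_graph n))"
  by (simp add: complete_graph_def finite_imp_finite_nsets)

lemma card_mod_window:
  assumes "s \<le> N"
  shows "card ((\<lambda>j. (i + j) mod N) ` {..<s}) = s"
proof -
  have "inj_on (\<lambda>j. (i + j) mod N) {..<s}"
  proof (rule inj_onI)
    fix x y :: nat
    assume "x \<in> {..<s}" "y \<in> {..<s}" "(i + x) mod N = (i + y) mod N"
    moreover have "[i + x = i + y] (mod N) \<Longrightarrow> [x = y] (mod N)"
      by (simp add: cong_add_lcancel_nat)
    ultimately show "x = y"
      using assms by (simp add: cong_def)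
  qed
  then show ?thesis by (simp add: card_image)
qed

lemma image_cyclic_window:
  assumes "edge_ordering G l" "card (edges G) > 0"
  shows "l ` cyclic_window G l s i = (\<lambda>j. (i + j) mod card (edges G)) ` {..<s}"
proof -
  have "l ` edges G = {..<card (edges G)}"
    using assms(1) by (simp add: edge_ordering_def bij_betw_def)
  moreover have "(i + j) mod card (edges G) \<in> {..<card (edges G)}" for j
    using assms(2) by simp
  ultimately show ?thesis
    unfolding cyclic_window_def by (auto simp: image_iff) (metis imageE lessThan_iff)
qed

lemma card_cyclic_window:
  assumes "edge_ordering G l" "s \<le> card (edges G)"
  shows "card (cyclic_window G l s i) = s"
proof (cases "card (edges G) = 0")
  case True
  then show ?thesis using assms by (auto simp: cyclic_window_def)
next
  case False
  have "inj_on l (cyclic_window G l s i)"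
    using assms(1) by (auto simp: edge_ordering_def bij_betw_def cyclic_window_def intro: inj_on_subset)
  then show ?thesis
    using image_cyclic_window[OF assms(1), of s i] card_mod_window[OF assms(2), of i] False
    by (metis card_image neq0_conv)
qed

lemma sum_degree:
  assumes "finite V" "finite W" "W \<subseteq> [V]\<^bsup>2\<^esup>"
  shows "(\<Sum>v\<in>V. degree (V, W) v) = 2 * card W"
proof -
  have "(\<Sum>v\<in>V. degree (V, W) v) = (\<Sum>v\<in>V. \<Sum>e | e \<in> W \<and> v \<in> e. 1)"
    by (simp add: degree_def)
  also have "\<dots> = (\<Sum>e\<in>W. \<Sum>v | v \<in> V \<and> v \<in> e. 1)"
    using assms(1,2) by (rule sum.swap_restrict)
  also have "\<dots> = (\<Sum>e\<in>W. 2)"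
  proof (rule sum.cong)
    fix e assume "e \<in> W"
    then have "e \<subseteq> V" "card e = 2" using assms(3) by (auto simp: nsets_def)
    moreover from this have "{v. v \<in> V \<and> v \<in> e} = e" by auto
    ultimately show "(\<Sum>v | v \<in> V \<and> v \<in> e. 1) = (2::nat)" by simp
  qed simp
  finally show ?thesis by simp
qed

lemma cms_ord_mem:
  "cms_ord r G l \<le> card (edges G) \<and>
    (\<forall>i < card (edges G). le_regular r (verts G, cyclic_window G l (cms_ord r G l) i))"
proof -
  have "cms_ord r G l \<in> {s. s \<le> card (edges G) \<and>
     (\<forall>i < card (edges G). le_regular r (verts G, cyclic_window G l s i))}"
    unfolding cms_ord_def using cms_ord_set[of G r l] by (intro Max_in) blast+
  then show ?thesis by simp
qed

lemma cms_geI: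
  assumes "simple_graph G" "edge_ordering G l" "s \<le> card (edges G)"
    and "\<And>i. i < card (edges G) \<Longrightarrow> le_regular r (verts G, cyclic_window G l s i)"
  shows "s \<le> cms r G"
proof -
  have "s \<le> cms_ord r G l"
    unfolding cms_ord_def using cms_ord_set(1)[of G r l] assms(3,4) by (intro Max_ge) auto
  also have "\<dots> \<le> cms r G"
    unfolding cms_def using cms_set(1)[OF assms(1)] assms(2) by (intro Max_ge) auto
  finally show ?thesis .
qed

text \<open>Both sides consist of the edges labelled \<open>0\<close> to \<open>s\<close>; the bound
  on \<open>s\<close> keeps this label from wrapping around.\<close>

lemma cyclic_window_shift:
  assumes "edge_ordering G l" "s < card (edges G)"
    and "a \<in> edges G" "l a = 0" "b \<in> edges G" "l b = s"
  shows "insert b (cyclic_window G l s 0) = insert a (cyclic_window G l s 1)"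
proof -
  define N where "N = card (edges G)"
  have lN: "l e < N" if "e \<in> edges G" for e
    using assms(1) that by (auto simp: edge_ordering_def N_def bij_betw_def)
  have inj: "inj_on l (edges G)"
    using assms(1) by (simp add: edge_ordering_def bij_betw_def)
  have 0: "(\<exists>j<s. x = (0 + j) mod N) \<longleftrightarrow> x < s" for x
    using assms(2) by (auto simp: N_def)
  have 1: "(\<exists>j<s. x = (1 + j) mod N) \<longleftrightarrow> 0 < x \<and> x \<le> s" for x
  proof
    assume "\<exists>j<s. x = (1 + j) mod N"
    then show "0 < x \<and> x \<le> s" using assms(2) by (auto simp: N_def)
  next
    assume "0 < x \<and> x \<le> s"
    then show "\<exists>j<s. x = (1 + j) mod N"
      using assms(2) by (intro exI[of _ "x - 1"]) (auto simp: N_def)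
  qed
  have "cyclic_window G l s 0 = {e \<in> edges G. l e < s}"
    "cyclic_window G l s 1 = {e \<in> edges G. 0 < l e \<and> l e \<le> s}"
    unfolding cyclic_window_def N_def[symmetric] 0 1 by simp_all
  moreover have "e = a" if "e \<in> edges G" "l e = 0" for e
    using inj_onD[OF inj, of e a] that assms(3,4) by simp
  moreover have "e = b" if "e \<in> edges G" "l e = s" for e
    using inj_onD[OF inj, of e b] that assms(5,6) by simp
  ultimately show ?thesis
    using assms(3-6) by (intro set_eqI) (smt (verit, best) insert_iff mem_Collect_eq not_gr_zero order_le_less)
qed

lemma cms_complete_graph_le:
  assumes "n \<ge> 3" "1 \<le> r" "r \<le> n - 2"
  shows "2 * cms r (complete_graph n) < r * n"
proof -
  define G where "G = complete_graph n"
  have E: "edges G = [{..<n}]\<^bsup>2\<^esup>" and V: "verts G = {..<n}"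
    by (simp_all add: G_def complete_graph_def)
  have sub: "cyclic_window G l s i \<subseteq> [{..<n}]\<^bsup>2\<^esup>" for l s i
    unfolding cyclic_window_def E by auto
  have fin: "finite (cyclic_window G l s i)" for l s i
    using finite_subset[OF sub] finite_edges_complete_graph[of n] by (simp add: complete_graph_def)
  have N: "2 * card (edges G) = n * (n - 1)"
  proof -
    have "even (n * (n - 1))" by (cases n) auto
    then show ?thesis unfolding G_def card_edges_complete_graph choose_two by simp
  qed
  have pos: "card (edges G) > 0" using N assms by (cases "card (edges G)") auto
  have "2 * cms_ord r G l < r * n" if l: "edge_ordering G l" for l
  proof -
    define s where "s = cms_ord r G l"
    have s: "s \<le> card (edges G)"
      and reg: "\<And>i v. i < card (edges G) \<Longrightarrow> v < n \<Longrightarrow> degree ({..<n}, cyclic_window G l s i) v \<le> r"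
      using cms_ord_mem[of r G l] unfolding s_def[symmetric] V by (auto simp: le_regular_def)
    have sum: "(\<Sum>v<n. degree ({..<n}, cyclic_window G l s i) v) = 2 * s" for i
      using sum_degree[OF _ fin sub] card_cyclic_window[OF l s] by simp
    have le: "2 * s \<le> r * n"
      using sum_mono[of "{..<n}" "degree ({..<n}, cyclic_window G l s 0)" "\<lambda>_. r"] sum[of 0] reg[OF pos]
      by (simp add: mult.commute)
    moreover have False if eq: "2 * s = r * n"
    proof -
      \<comment> \<open>Since \<open>r < n - 1\<close>, such a window omits at least one edge, so an
        edge \<open>b\<close> with label \<open>s\<close> exists.\<close>
      have "r * n < (n - 1) * n" using assms by (intro mult_strict_right_mono) auto
      then have sN: "s < card (edges G)" using eq N mult.commute[of n "n - 1"] by linarith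
      have s0: "s > 0" using eq assms by (cases s) auto
      have deg: "degree ({..<n}, cyclic_window G l s i) v = r" if "i < card (edges G)" "v < n" for i v
      proof (rule ccontr)
        assume "degree ({..<n}, cyclic_window G l s i) v \<noteq> r"
        then have "degree ({..<n}, cyclic_window G l s i) v < r" using reg that by force
        then have "(\<Sum>v<n. degree ({..<n}, cyclic_window G l s i) v) < (\<Sum>v<n. r)"
          using reg[OF that(1)] that(2) by (intro sum_strict_mono_ex1) auto
        then show False using sum[of i] eq by simp
      qed
      have surj: "l ` edges G = {..<card (edges G)}"
        using l by (simp add: edge_ordering_def bij_betw_def)
      obtain a where a: "a \<in> edges G" "l a = 0"
        using surj pos by (metis imageE lessThan_iff)
      obtain b where b: "b \<in> edges G" "l b = s"
        using surj sN by (metis imageE lessThan_iff)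
      have shift: "insert b (cyclic_window G l s 0) = insert a (cyclic_window G l s 1)"
        using cyclic_window_shift[OF l sN a b] .
      have c1: "1 < card (edges G)" using s0 sN by simp
      have nb: "b \<notin> cyclic_window G l s 0"
        using b sN by (auto simp: cyclic_window_def)
      have na: "a \<notin> cyclic_window G l s 1"
        using a sN by (auto simp: cyclic_window_def)
      have ins: "degree ({..<n}, insert c W) v = degree ({..<n}, W) v + of_bool (v \<in> c)"
        if "c \<notin> W" "finite W" for c W v
      proof -
        have "{e \<in> insert c W. v \<in> e} = (if v \<in> c then insert c {e \<in> W. v \<in> e} else {e \<in> W. v \<in> e})"
          by auto
        then show ?thesis using that by (simp add: degree_def)
      qed
      \<comment> \<open>Both windows are \<open>r\<close>-regular, so adding \<open>b\<close> to the
        one and \<open>a\<close> to the other must raise the same degrees.\<close>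
      have "v \<in> a \<longleftrightarrow> v \<in> b" if "v < n" for v
      proof -
        have "r + of_bool (v \<in> b) = r + of_bool (v \<in> a)"
          unfolding deg[OF pos that, symmetric] ins[OF nb fin, symmetric] shift
          unfolding deg[OF pos that] ins[OF na fin] deg[OF c1 that] ..
        then show ?thesis by (cases "v \<in> a"; cases "v \<in> b") simp_all
      qed
      moreover have "a \<subseteq> {..<n}" "b \<subseteq> {..<n}" using a b by (auto simp: E nsets_def)
      ultimately have "a = b" by blast
      then show False using a b s0 by simp
    qed
    ultimately show ?thesis unfolding s_def by fastforce
  qed
  moreover have "cms r G \<in> {cms_ord r G l | l. edge_ordering G l}"
    unfolding cms_def using cms_set[of G r] simple_graph_complete_graph
    unfolding G_def by (intro Max_in) auto
  ultimately show ?thesis unfolding G_def by auto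
qed

text \<open>A window of \<open>rm - 1\<close> labels meets at most \<open>r + 1\<close> blocks; a vertex hit in all of them would
  have dropped by at least 2 in position between the first and the last of these blocks.\<close>

lemma le_regular_blocks:
  fixes t q :: "'a set \<Rightarrow> nat"
  assumes N: "card (edges G) = K * m" and m: "m > 0"
    and l: "\<And>e. e \<in> edges G \<Longrightarrow> l e = t e * m + q e"
    and qm: "\<And>e. e \<in> edges G \<Longrightarrow> q e < m"
    and inj: "\<And>v. v \<in> verts G \<Longrightarrow> inj_on t {e \<in> edges G. v \<in> e}"
    and step: "\<And>v e e'. v \<in> verts G \<Longrightarrow> e \<in> edges G \<Longrightarrow> e' \<in> edges G \<Longrightarrow> v \<in> e \<Longrightarrow> v \<in> e' \<Longrightarrow>
      t e' = (t e + r) mod K \<Longrightarrow> q e \<le> Suc (q e')"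
    and r: "1 \<le> r" "r < K" and i: "i < card (edges G)"
  shows "le_regular r (verts G, cyclic_window G l (r * m - 1) i)"
  unfolding le_regular_def degree_def fst_conv snd_conv
proof (intro ballI)
  fix v assume v: "v \<in> verts G"
  define A where "A = {e \<in> cyclic_window G l (r * m - 1) i. v \<in> e}"
  define T where "T = i div m"
  \<comment> \<open>The number \<open>i + j\<close> is the label before reduction modulo
    \<open>K * m\<close>; labels of a window that passes the end of the ordering can thus be
    compared as integers.\<close>
  have ex: "\<exists>k j. k \<le> r \<and> j < r * m - 1 \<and> i + j = (T + k) * m + q e \<and> t e = (T + k) mod K"
    if "e \<in> A" for e
  proof -
    from that obtain j where e: "e \<in> edges G" and j: "j < r * m - 1" "l e = (i + j) mod (K * m)"
      by (auto simp: A_def cyclic_window_def N)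
    have "(i + j) mod (K * m) = m * ((i + j) div m mod K) + (i + j) mod m"
      by (metis mod_mult2_eq mult.commute)
    then have eq: "t e * m + q e = ((i + j) div m mod K) * m + (i + j) mod m"
      using l[OF e] j(2) by (simp add: mult.commute)
    have t: "t e = (i + j) div m mod K" 
      using arg_cong[OF eq, of "\<lambda>x. x div m"] qm[OF e] m by simp
    have q: "q e = (i + j) mod m"
      using arg_cong[OF eq, of "\<lambda>x. x mod m"] qm[OF e] m by simp
    have "(i + j) div m \<ge> T" unfolding T_def by (simp add: div_le_mono)
    moreover have "(i + j) div m \<le> T + r"
    proof -
      have "(i + j) div m \<le> (i + r * m) div m" using j by (intro div_le_mono) auto
      also have "\<dots> = T + r" using m by (simp add: T_def)
      finally show ?thesis .
    qed
    ultimately have "(i + j) div m = T + ((i + j) div m - T)" "(i + j) div m - T \<le> r" by auto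
    then show ?thesis
      using j(1) t q by (intro exI[of _ "(i + j) div m - T"] exI[of _ j]) auto
  qed
  have AE: "A \<subseteq> {e \<in> edges G. v \<in> e}" by (auto simp: A_def cyclic_window_def)
  have injA: "inj_on t A" using inj[OF v] AE inj_on_subset by blast
  \<comment> \<open>As \<open>r < K\<close>, these \<open>r + 1\<close> block numbers are distinct.
    Edges at \<open>v\<close> lie in different blocks, so it suffices that one of the blocks
    contributes no edge to \<open>A\<close>.\<close>
  define U where "U = (\<lambda>k. (T + k) mod K) ` {..<Suc r}"
  have tU: "t ` A \<subseteq> U" using ex by (force simp: U_def less_Suc_eq_le)
  have cU: "card U = Suc r" unfolding U_def using r by (intro card_mod_window) auto
  have "t ` A \<noteq> U"
  proof
    assume eq: "t ` A = U"
    have "(T + 0) mod K \<in> U" unfolding U_def by (rule imageI) simp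
    then obtain e where e: "e \<in> A" "t e = T mod K" using eq by auto
    have "(T + r) mod K \<in> U" unfolding U_def by (rule imageI) simp
    then obtain e' where e': "e' \<in> A" "t e' = (T + r) mod K" using eq by (metis imageE)
    have uniq: "k = k'" if "k \<le> r" "k' \<le> r" "(T + k) mod K = (T + k') mod K" for k k'
    proof -
      have "inj_on (\<lambda>k. (T + k) mod K) {..<Suc r}"
        using cU unfolding U_def by (intro eq_card_imp_inj_on) auto
      then show ?thesis using that by (auto dest!: inj_onD)
    qed
    obtain k j where kj: "k \<le> r" "i + j = (T + k) * m + q e" "t e = (T + k) mod K" 
      using ex[OF e(1)] by blast
    have "k = 0" using uniq[of k 0] kj e by simp
    obtain k' j' where kj': "k' \<le> r" "j' < r * m - 1" "i + j' = (T + k') * m + q e'" "t e' = (T + k') mod K"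
      using ex[OF e'(1)] by blast
    have "k' = r" using uniq[of k' r] kj' e' by simp
    \<comment> \<open>The unreduced label of \<open>e\<close> is at least \<open>i\<close>, that of
      \<open>e'\<close> at most \<open>i + r * m - 2\<close>. The two blocks start
      \<open>r * m\<close> apart, so the position would fall by at least 2; the \<open>- 1\<close>
      in the window length is what excludes a fall by just 1.\<close>
    have "i \<le> T * m + q e" using kj \<open>k = 0\<close> by simp
    moreover have "T * m + r * m + q e' < i + r * m - 1"
      using kj' \<open>k' = r\<close> by (simp add: distrib_right)
    moreover have "q e \<le> Suc (q e')"
      using step[OF v, of e e'] AE e e' by (auto simp: mod_add_left_eq)
    ultimately show False by linarith
  qed
  then have "card (t ` A) < card U" using tU by (intro psubset_card_mono) (auto simp: U_def)
  then show "card {e \<in> cyclic_window G l (r * m - 1) i. v \<in> e} \<le> r"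
    using cU card_image[OF injA] by (simp add: A_def)
qed

section \<open>Even order\<close>

text \<open>For odd \<open>p\<close>, the pairs \<open>{x, y}\<close> of residues with a given sum form a near-perfect matching of
  \<open>K\<^sub>p\<close>, the loop being the unmatched residue \<open>c\<close>; \<open>half_gap p x y\<close> is the \<open>h\<close> for which
  \<open>{x, y} = {c - h, c + h}\<close> modulo \<open>p\<close>.\<close>

definition half_gap :: "nat \<Rightarrow> nat \<Rightarrow> nat \<Rightarrow> nat" where
  "half_gap p x y = (let e = (if x \<le> y then y - x else x - y) in if even e then e div 2 else (p - e) div 2)"

lemma half_gap_commute: "half_gap p x y = half_gap p y x"
  by (auto simp: half_gap_def)

lemma half_gap_refl [simp]: "half_gap p x x = 0"
  by (simp add: half_gap_def)

text \<open>For odd \<open>p\<close>, exactly one of \<open>y - x\<close> and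
  \<open>p - (y - x)\<close> is even, and the parity of \<open>x + y\<close> tells which. Later
  arguments thereby reduce to linear arithmetic.\<close>

lemma double_half_gap:
  assumes "odd p" "x \<le> y" "y < p"
  shows "if even (x + y) then y = 2 * half_gap p x y + x else p + x = 2 * half_gap p x y + y"
  using assms by (auto simp: half_gap_def Let_def)

lemma half_gap_le:
  assumes "odd p" "x < p" "y < p"
  shows "2 * half_gap p x y < p"
  using double_half_gap[of p x y] double_half_gap[of p y x] half_gap_commute[of p x y] assms
  by (cases x y rule: linorder_cases) (auto split: if_splits)

lemma half_gap_pos:
  assumes "odd p" "x < p" "y < p" "x \<noteq> y"
  shows "half_gap p x y > 0"
  using double_half_gap[of p x y] double_half_gap[of p y x] half_gap_commute[of p x y] assms
  by (cases x y rule: linorder_cases) (auto split: if_splits)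

lemma mod_sum_cases:
  assumes "x < p" "y < (p::nat)"
  shows "(x + y) mod p = (if x + y < p then x + y else x + y - p)"
  using assms by (auto simp: le_mod_geq not_less)

lemma sum_mod_cancel:
  fixes x :: nat
  assumes "x < p" "y < p" "y' < p" "(x + y) mod p = (x + y') mod p"
  shows "y = y'"
  using assms by (auto simp: mod_sum_cases split: if_splits)

text \<open>The sum determines the centre \<open>c\<close>, and the gap then determines the pair
  \<open>{c - h, c + h}\<close>.\<close>

lemma sum_half_gap_inj:
  assumes p: "odd p" and xy: "x \<le> y" "y < p" "x' \<le> y'" "y' < p"
    and sum: "(x + y) mod p = (x' + y') mod p" and gap: "half_gap p x y = half_gap p x' y'"
  shows "x = x' \<and> y = y'"
proof -
  define h where "h = half_gap p x y"
  define P Q where "P \<longleftrightarrow> even (x + y)" and "Q \<longleftrightarrow> even (x' + y')"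
  have "x + y = x' + y' \<or> x + y = x' + y' + p \<or> x' + y' = x + y + p"
    using xy sum by (auto simp: mod_sum_cases split: if_splits)
  \<comment> \<open>Sums congruent modulo the odd number \<open>p\<close> are equal if their
    parities agree, and differ by exactly \<open>p\<close> otherwise.\<close>
  then have "if P = Q then x + y = x' + y' else x + y = x' + y' + p \<or> x' + y' = x + y + p"
    using p unfolding P_def Q_def by (metis even_add)
  moreover have "if P then y = 2 * h + x else p + x = 2 * h + y"
    using double_half_gap[OF p xy(1,2)] by (simp add: P_def h_def)
  moreover have "if Q then y' = 2 * h + x' else p + x' = 2 * h + y'"
    using double_half_gap[OF p xy(3,4)] by (simp add: Q_def h_def gap)
  ultimately show ?thesis
    using xy by (cases P; cases Q) auto
qed

text \<open>The gap is the circular distance from \<open>x\<close> to the centre of the pair.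
  Raising the sum by 2 moves the centre by one residue, which changes this distance by at most
  1.\<close>

lemma half_gap_step:
  assumes "odd p" "p > 1" "x < p" "y < p" "y' < p" "(x + y') mod p = (x + y + 2) mod p"
  shows "half_gap p x y \<le> Suc (half_gap p x y')"
proof -
  define P Q where "P \<longleftrightarrow> even (x + y)" and "Q \<longleftrightarrow> even (x + y')"
  have "(x + y') mod p = (x + (y + 2) mod p) mod p"
    using assms(6) by (simp add: mod_add_right_eq add.assoc)
  then have y': "y' = (y + 2) mod p"
    using sum_mod_cancel[of x p y' "(y + 2) mod p"] assms(2,3,5) by simp
  have p: "p \<ge> 3" using assms(1,2) by presburger
  have "y' = y + 2 \<or> y' + p = y + 2"
    using y' p assms(4,5) by (cases "y + 2 < p") (auto simp: le_mod_geq not_less)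
  then have y'_cases: "if P = Q then y' = y + 2 else y' + p = y + 2"
    using assms(1) unfolding P_def Q_def by (metis even_add even_numeral)
  have gap: "if even (x + z) then z = 2 * half_gap p x z + x \<or> x = 2 * half_gap p x z + z
      else x \<le> z \<and> p + x = 2 * half_gap p x z + z \<or> z \<le> x \<and> p + z = 2 * half_gap p x z + x"
    if "z < p" for z
    using double_half_gap[of p x z] double_half_gap[of p z x] half_gap_commute[of p x z] that assms(1,3)
    by (cases "x \<le> z") (auto simp: add.commute)
  define h h' where "h = half_gap p x y" and "h' = half_gap p x y'"
  have "h \<le> Suc h'"
    using y'_cases gap[OF assms(4)] gap[OF assms(5)] assms(3-5) p
    unfolding P_def[symmetric] Q_def[symmetric] h_def[symmetric] h'_def[symmetric]
    by (cases P; cases Q; simp only: if_True if_False simp_thms; elim disjE conjE; linarith)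
  then show ?thesis by (simp add: h_def h'_def)
qed

text \<open>The vertex \<open>x\<close> is element \<open>x mod L\<close> of group \<open>x div L\<close>. A loop \<open>(x, x)\<close> stands for the edge
  from \<open>x\<close> to infinity. \<open>pair_group\<close> selects the spanning \<open>L\<close>-regular graph, \<open>pair_sum\<close> a perfect matching
  in it and \<open>pair_pos\<close> the position in this matching. The next matching is the one whose \<open>pair_sum\<close> is
  larger by 2; this is why differences are doubled between distinct groups.\<close>

definition pair_group :: "nat \<Rightarrow> nat \<Rightarrow> nat \<Rightarrow> nat \<Rightarrow> nat" where
  "pair_group g L x y = (x div L + y div L) mod g"

definition pair_sum :: "nat \<Rightarrow> nat \<Rightarrow> nat \<Rightarrow> nat" where
  "pair_sum L x y =
    (if x div L = y div L then (x mod L + y mod L) mod L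
     else if x div L < y div L then 2 * (L + y mod L - x mod L) mod L
     else 2 * (L + x mod L - y mod L) mod L)"

definition pair_pos :: "nat \<Rightarrow> nat \<Rightarrow> nat \<Rightarrow> nat \<Rightarrow> nat" where
  "pair_pos g L x y =
    (if x div L = y div L then half_gap L (x mod L) (y mod L)
     else (L + 1) div 2 + L * (half_gap g (x div L) (y div L) - 1)
       + (if x div L < y div L then x mod L else y mod L))"

lemma pair_commute:
  "pair_group g L x y = pair_group g L y x"
  "pair_sum L x y = pair_sum L y x"
  "pair_pos g L x y = pair_pos g L y x"
  by (auto simp: pair_group_def pair_sum_def pair_pos_def add.commute half_gap_commute)

lemma pair_sum_same: "x div L = y div L \<Longrightarrow> pair_sum L x y = (x mod L + y mod L) mod L"
  and pair_sum_greater: "y div L < x div L \<Longrightarrow> pair_sum L x y = 2 * (L + x mod L - y mod L) mod L"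
  by (simp_all add: pair_sum_def)

text \<open>Pairs within a group, loops included, take the first \<open>(L + 1) div 2\<close>
  positions, and each of the \<open>(g - 1) div 2\<close> nonzero gaps between groups takes
  \<open>L\<close> more. In total these are \<open>(g * L + 1) div 2\<close> positions.\<close>

lemma pair_pos_less:
  assumes "odd g" "odd L" "x < g * L" "y < g * L"
  shows "2 * pair_pos g L x y < g * L + 1"
proof -
  have L: "L > 0" and div: "x div L < g" "y div L < g"
    using assms by (auto simp: less_mult_imp_div_less odd_pos)
  have g: "g \<ge> 1" using assms(1) by (simp add: odd_pos Suc_leI)
  show ?thesis
  proof (cases "x div L = y div L")
    case True
    have "2 * pair_pos g L x y < L"
      using half_gap_le[OF assms(2)] L True by (simp add: pair_pos_def)
    also have "1 * L \<le> g * L" using g by (intro mult_right_mono) auto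
    finally show ?thesis by simp
  next
    case False
    define \<delta> where "\<delta> = half_gap g (x div L) (y div L)"
    have "2 * \<delta> < g" "\<delta> > 0"
      unfolding \<delta>_def using half_gap_le half_gap_pos div False assms(1) by auto
    then have "2 * \<delta> + 1 \<le> g" by simp
    then have "(2 * (\<delta> - 1) + 3) * L \<le> g * L"
      using \<open>\<delta> > 0\<close> by (intro mult_right_mono) auto
    then have "2 * (L * (\<delta> - 1)) + 3 * L \<le> g * L"
      by (simp add: algebra_simps)
    moreover have "(if x div L < y div L then x mod L else y mod L) < L" using L by simp
    moreover have "2 * ((L + 1) div 2) = L + 1" using assms(2) by simp
    ultimately show ?thesis using False by (simp add: pair_pos_def \<delta>_def[symmetric])
  qed
qed

text \<open>The factor 2 cancels modulo the odd number \<open>L\<close>; the summand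
  \<open>L\<close> only guards the truncated subtraction.\<close>

lemma double_diff_cong:
  fixes L :: nat
  assumes "odd L" "a < L" "b < L" "a' < L" "b' < L"
    and "2 * (L + b' - a') mod L = (2 * (L + b - a) + 2 * k) mod L"
  shows "[b' + a = b + a' + k] (mod L)"
proof -
  have "[2 * (L + b' - a') = 2 * (L + b - a + k)] (mod L)"
    using assms(6) by (simp add: cong_def algebra_simps)
  then have "[L + b' - a' = L + b - a + k] (mod L)"
    using cong_mult_lcancel_nat[of 2 L "L + b' - a'" "L + b - a + k"] assms(1)
    by (simp only: coprime_left_2_iff_odd not_False_eq_True simp_thms)
  then have "[L + b' - a' + (a + a') = L + b - a + k + (a + a')] (mod L)"
    by (rule cong_add) simp
  moreover have "L + b' - a' + (a + a') = L + (b' + a)"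
    "L + b - a + k + (a + a') = L + (b + a' + k)" using assms by auto
  ultimately have "[L + (b' + a) = L + (b + a' + k)] (mod L)" by (simp only:)
  then show ?thesis by (simp only: cong_add_lcancel_nat)
qed

text \<open>This is the matching property: the first equation fixes the group of the partner of
  \<open>x\<close>, the second its residue in that group.\<close>

lemma pair_inj_vertex:
  assumes "odd L" "x < g * L" "y < g * L" "y' < g * L"
    and "pair_group g L x y = pair_group g L x y'"
    and "pair_sum L x y = pair_sum L x y'"
  shows "y = y'"
proof -
  have L: "L > 0" and div: "x div L < g" "y div L < g" "y' div L < g"
    using assms by (auto simp: less_mult_imp_div_less odd_pos)
  have c: "y div L = y' div L"
    using sum_mod_cancel[OF div] assms(5) by (simp add: pair_group_def)
  have lt: "x mod L < L" "y mod L < L" "y' mod L < L" using L by auto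
  consider "x div L = y div L" | "x div L < y div L" | "y div L < x div L" by linarith
  then have "y mod L = y' mod L"
  proof cases
    case 1
    then show ?thesis
      using sum_mod_cancel[OF lt] assms(6) c by (simp add: pair_sum_def)
  next
    case 2
    then have "[y mod L + x mod L = y' mod L + x mod L + 0] (mod L)"
      using assms(6) c by (intro double_diff_cong[OF assms(1) lt(1,3,1,2)]) (simp add: pair_sum_def)
    then have "[y mod L = y' mod L] (mod L)" by (simp only: add_0_right cong_add_rcancel_nat)
    then show ?thesis by (simp add: cong_def)
  next
    case 3
    then have "[x mod L + y' mod L = x mod L + y mod L + 0] (mod L)"
      using assms(6) c by (intro double_diff_cong[OF assms(1) lt(3,1,2,1)]) (simp add: pair_sum_def)
    then have "[y' mod L = y mod L] (mod L)" by (simp only: add_0_right cong_add_lcancel_nat)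
    then show ?thesis by (simp add: cong_def)
  qed
  with c show ?thesis by (metis div_mult_mod_eq)
qed

text \<open>Inside a group this is \<open>half_gap_step\<close>. Between groups the position follows
  the endpoint in the lower group: if that is \<open>x\<close>, nothing changes; otherwise it is the
  partner, whose residue goes down by 1 modulo \<open>L\<close>, so the position drops by 1 or jumps
  up.\<close>

lemma pair_pos_step:
  assumes "odd L" "L > 1" "x < g * L" "y < g * L" "y' < g * L"
    and "pair_group g L x y' = pair_group g L x y"
    and "pair_sum L x y' = (pair_sum L x y + 2) mod L"
  shows "pair_pos g L x y \<le> Suc (pair_pos g L x y')"
proof -
  have L: "L > 0" and div: "x div L < g" "y' div L < g" "y div L < g"
    using assms by (auto simp: less_mult_imp_div_less odd_pos)
  have c: "y' div L = y div L"
    using sum_mod_cancel[OF div] assms(6) by (simp add: pair_group_def)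
  have lt: "x mod L < L" "y mod L < L" "y' mod L < L" using L by auto
  consider "x div L = y div L" | "x div L < y div L" | "y div L < x div L" by linarith
  then show ?thesis
  proof cases
    case 1
    then have "(x mod L + y' mod L) mod L = ((x mod L + y mod L) mod L + 2) mod L"
      using assms(7) c by (simp only: pair_sum_same)
    then have "(x mod L + y' mod L) mod L = (x mod L + y mod L + 2) mod L"
      by (simp only: mod_add_left_eq[of "x mod L + y mod L"])
    then have "half_gap L (x mod L) (y mod L) \<le> Suc (half_gap L (x mod L) (y' mod L))"
      by (intro half_gap_step[OF assms(1,2) lt])
    then show ?thesis using 1 c by (simp add: pair_pos_def)
  next
    case 2
    then show ?thesis using c by (simp add: pair_pos_def)
  next
    case 3
    then have "2 * (L + x mod L - y' mod L) mod L = (2 * (L + x mod L - y mod L) mod L + 2) mod L"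
      using assms(7) c by (simp only: pair_sum_greater)
    then have "2 * (L + x mod L - y' mod L) mod L = (2 * (L + x mod L - y mod L) + 2 * 1) mod L"
      by (simp only: mod_add_left_eq mult_1_right)
    then have "[x mod L + y mod L = x mod L + y' mod L + 1] (mod L)"
      by (rule double_diff_cong[OF assms(1) lt(2,1,3,1)])
    then have "[y mod L = y' mod L + 1] (mod L)" by (simp only: add.assoc cong_add_lcancel_nat)
    then have "y mod L = (y' mod L + 1) mod L" by (simp add: cong_def)
    then have "y mod L \<le> y' mod L + 1" by (metis mod_less_eq_dividend)
    then show ?thesis using 3 c by (simp add: pair_pos_def)
  qed
qed

text \<open>The position can be decoded: its size tells whether the groups agree, and between
  different groups quotient and remainder by \<open>L\<close> give the gap of the groups and the
  residue of the lower endpoint. The matching then yields the other endpoint.\<close>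

lemma pair_inj:
  assumes "odd g" "odd L" "x \<le> y" "y < g * L" "x' \<le> y'" "y' < g * L"
    and group: "pair_group g L x y = pair_group g L x' y'"
    and sum: "pair_sum L x y = pair_sum L x' y'"
    and pos: "pair_pos g L x y = pair_pos g L x' y'"
  shows "x = x' \<and> y = y'"
proof -
  have L: "L > 0" and div: "y div L < g" "y' div L < g"
    using assms by (auto simp: less_mult_imp_div_less odd_pos)
  have le: "x div L \<le> y div L" "x' div L \<le> y' div L" using assms by (auto simp: div_le_mono)
  have lt: "x mod L < L" "y mod L < L" "x' mod L < L" "y' mod L < L" using L by auto
  have low: "pair_pos g L u v < (L + 1) div 2 \<longleftrightarrow> u div L = v div L" for u v
    using half_gap_le[OF assms(2), of "u mod L" "v mod L"] L by (auto simp: pair_pos_def)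
  have same: "x div L = y div L \<longleftrightarrow> x' div L = y' div L"
    using low[of x y] low[of x' y'] pos by simp
  have group': "(x div L + y div L) mod g = (x' div L + y' div L) mod g"
    using group by (simp add: pair_group_def)
  show ?thesis
  proof (cases "x div L = y div L")
    case True
    then have "half_gap g (x div L) (y div L) = half_gap g (x' div L) (y' div L)"
      using same by simp
    then have d: "x div L = x' div L \<and> y div L = y' div L"
      using sum_half_gap_inj[OF assms(1) le(1) div(1) le(2) div(2) group'] by simp
    have "u mod L \<le> v mod L" if "u \<le> v" "u div L = v div L" for u v
      using that by (metis add_le_cancel_left div_mult_mod_eq)
    then have "x mod L \<le> y mod L" "x' mod L \<le> y' mod L" using True same assms(3,5) by auto
    then have "x mod L = x' mod L \<and> y mod L = y' mod L"
      using sum_half_gap_inj[OF assms(2) _ lt(2) _ lt(4)] sum pos True same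
      by (simp add: pair_sum_def pair_pos_def)
    with d show ?thesis by (metis div_mult_mod_eq)
  next
    case False
    define \<delta> \<delta>' where "\<delta> = half_gap g (x div L) (y div L)" and "\<delta>' = half_gap g (x' div L) (y' div L)"
    have "\<delta> > 0" "\<delta>' > 0"
      unfolding \<delta>_def \<delta>'_def using False same le div by (auto intro!: half_gap_pos[OF assms(1)])
    have "x div L < y div L" "x' div L < y' div L" using False same le by auto
    then have eq: "L * (\<delta> - 1) + x mod L = L * (\<delta>' - 1) + x' mod L"
      using pos by (simp add: pair_pos_def \<delta>_def \<delta>'_def)
    have "\<delta> - 1 = \<delta>' - 1" using arg_cong[OF eq, of "\<lambda>z. z div L"] L by simp
    then have "\<delta> = \<delta>'" using \<open>\<delta> > 0\<close> \<open>\<delta>' > 0\<close> by simp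
    then have d: "x div L = x' div L \<and> y div L = y' div L"
      using sum_half_gap_inj[OF assms(1) le(1) div(1) le(2) div(2) group']
      by (simp add: \<delta>_def \<delta>'_def)
    have "x mod L = x' mod L" using arg_cong[OF eq, of "\<lambda>z. z mod L"] by simp
    with d have "x = x'" by (metis div_mult_mod_eq)
    moreover from this have "y = y'"
      using pair_inj_vertex[OF assms(2) _ assms(4,6), of x] group sum assms(3,4) by simp
    ultimately show ?thesis by simp
  qed
qed

section \<open>Edges of the complete graph as pairs of residues\<close>

lemma edge_ordered_ends:
  fixes n :: nat
  assumes "e \<in> [{..<n}]\<^bsup>2\<^esup>"
  obtains a b where "e = {a, b}" "a < b" "b < n"
proof -
  obtain x y where "e = {x, y}" "x \<noteq> y" "x < n" "y < n"
    using assms by (auto simp: nsets_2_eq)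
  then show ?thesis
    using that[of x y] that[of y x] by (cases "x < y") (auto simp: insert_commute)
qed

text \<open>The vertex \<open>K\<close> serves as infinity, so its edges become the loops.\<close>

definition edge_pair :: "nat \<Rightarrow> nat set \<Rightarrow> nat \<times> nat" where
  "edge_pair K e = (Min e, if Max e = K then Min e else Max e)"

lemma edge_pair_insert:
  assumes "a < b"
  shows "edge_pair K {a, b} = (a, if b = K then a else b)"
  using assms by (simp add: edge_pair_def)

lemma edge_pair_range:
  assumes "e \<in> [{..<Suc K}]\<^bsup>2\<^esup>"
  shows "fst (edge_pair K e) \<le> snd (edge_pair K e)" "snd (edge_pair K e) < K"
proof -
  obtain a b where "e = {a, b}" "a < b" "b < Suc K"
    using edge_ordered_ends[OF assms] .
  then show "fst (edge_pair K e) \<le> snd (edge_pair K e)" "snd (edge_pair K e) < K"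
    by (auto simp: edge_pair_insert)
qed

lemma inj_on_edge_pair: "inj_on (edge_pair K) ([{..<Suc K}]\<^bsup>2\<^esup>)"
proof (rule inj_onI)
  fix e e' assume e: "e \<in> [{..<Suc K}]\<^bsup>2\<^esup>" "e' \<in> [{..<Suc K}]\<^bsup>2\<^esup>"
    and eq: "edge_pair K e = edge_pair K e'"
  obtain a b where ab: "e = {a, b}" "a < b" "b < Suc K" using edge_ordered_ends[OF e(1)] .
  obtain a' b' where ab': "e' = {a', b'}" "a' < b'" "b' < Suc K" using edge_ordered_ends[OF e(2)] .
  show "e = e'" using eq ab ab' by (simp add: edge_pair_insert split: if_splits)
qed

lemma edge_pair_incident:
  assumes "e \<in> [{..<Suc K}]\<^bsup>2\<^esup>" "v \<in> e" "v < K"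
  obtains y where "y < K" "edge_pair K e = (v, y) \<or> edge_pair K e = (y, v)"
proof -
  obtain a b where "e = {a, b}" "a < b" "b < Suc K"
    using edge_ordered_ends[OF assms(1)] .
  then have "edge_pair K e = (a, if b = K then a else b)" "v = a \<or> v = b" "a < K"
    using assms(2) by (auto simp: edge_pair_insert)
  then show ?thesis using assms(3) \<open>b < Suc K\<close> that[of a] that[of b] by (cases "b = K") auto
qed

lemma edge_pair_infinity:
  assumes "e \<in> [{..<Suc K}]\<^bsup>2\<^esup>" "K \<in> e"
  shows "fst (edge_pair K e) = snd (edge_pair K e)"
proof -
  obtain a b where "e = {a, b}" "a < b" "b < Suc K"
    using edge_ordered_ends[OF assms(1)] .
  then show ?thesis using assms(2) by (auto simp: edge_pair_insert)
qed

section \<open>The ordering for even order\<close>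

lemma even_complete_graph_ordering:
  fixes g L r' :: nat
  assumes g: "odd g" and L: "odd L" "L > 1" and r': "coprime r' L" "r' > 0" "r' < L"
  defines "K \<equiv> g * L" and "m \<equiv> (g * L + 1) div 2"
  shows "g * r' * m - 1 \<le> cms (g * r') (complete_graph (Suc K))"
proof -
  define G where "G = complete_graph (Suc K)"
  have E: "edges G = [{..<Suc K}]\<^bsup>2\<^esup>" and V: "verts G = {..<Suc K}"
    by (simp_all add: G_def complete_graph_def)
  \<comment> \<open>Modulo \<open>L\<close>, \<open>(L + 1) div 2\<close> is the inverse of 2, so
    \<open>w\<close> is half of \<open>r'\<close>.\<close>
  define w where "w = r' * ((L + 1) div 2)"
  define X Y where "X e = fst (edge_pair K e)" and "Y e = snd (edge_pair K e)" for e
  \<comment> \<open>The block number. Advancing it by \<open>g * r'\<close> modulo \<open>K\<close>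
    keeps the group sum, its residue modulo \<open>g\<close>, and adds \<open>r'\<close> to
    \<open>w * pair_sum\<close>, which means adding 2 to \<open>pair_sum\<close>.\<close>
  define T where "T x y = pair_group g L x y + g * ((w * pair_sum L x y) mod L)" for x y
  define t where "t e = T (X e) (Y e)" for e
  define q where "q e = pair_pos g L (X e) (Y e)" for e
  define l where "l e = t e * m + q e" for e
  have gpos: "g > 0" using g by (rule odd_pos)
  have oddK: "odd K" using g L by (simp add: K_def)
  have m2: "2 * m = K + 1" using oddK by (simp add: m_def K_def)
  have N: "card (edges G) = K * m"
  proof -
    have "2 * (K * m) = Suc K * K" using m2 by (simp add: algebra_simps)
    then show ?thesis unfolding G_def card_edges_complete_graph choose_two
      by (metis diff_Suc_1 nonzero_mult_div_cancel_left zero_neq_numeral)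
  qed
  have w: "coprime w L" "[2 * w = r'] (mod L)"
  proof -
    have "2 * ((L + 1) div 2) = L + 1" using L(1) by simp
    then have c: "2 * w = r' * L + r'"
      unfolding w_def by (metis distrib_left mult.left_commute mult_1_right)
    then show 2: "[2 * w = r'] (mod L)" by (simp add: cong_def)
    have "coprime (2 * w) L" using r'(1) cong_imp_coprime[OF cong_sym[OF 2]] by blast
    then show "coprime w L" by simp
  qed
  have pair: "X e \<le> Y e" "Y e < K" if "e \<in> edges G" for e
    using edge_pair_range that unfolding E X_def Y_def by auto
  have group_less: "pair_group g L x y < g" for x y using gpos by (simp add: pair_group_def)
  \<comment> \<open>With \<open>k = 0\<close> this shows that the block number determines the
    matching; with \<open>k = r'\<close> it describes the passage to the block \<open>g * r'\<close>
    later.\<close>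
  have T_shift: "pair_group g L x y' = pair_group g L z y \<and>
      [w * pair_sum L x y' = w * pair_sum L z y + k] (mod L)"
    if "T x y' = (T z y + g * k) mod K" for x y z y' k
  proof -
    define u where "u = (w * pair_sum L z y) mod L"
    have "(T z y + g * k) mod K = (pair_group g L z y + g * (u + k)) mod (g * L)"
      by (simp add: T_def u_def K_def algebra_simps)
    also have "\<dots> = g * ((u + k) mod L) + pair_group g L z y"
      using group_less[of z y] gpos by (simp add: mod_mult2_eq)
    finally have eq: "pair_group g L x y' + g * ((w * pair_sum L x y') mod L)
        = pair_group g L z y + g * ((u + k) mod L)"
      using that by (simp add: T_def)
    have 1: "pair_group g L x y' = pair_group g L z y"
      using arg_cong[OF eq, of "\<lambda>a. a mod g"] group_less[of x y'] group_less[of z y] by simp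
    then have "(w * pair_sum L x y') mod L = (u + k) mod L" using eq gpos by simp
    then show ?thesis using 1 by (simp add: cong_def u_def mod_add_left_eq)
  qed
  have sum_less: "pair_sum L x y < L" for x y using L by (simp add: pair_sum_def)
  have T_less: "T x y < K" for x y
  proof -
    have "w * pair_sum L x y mod L \<le> L - 1" using L(2) by (simp add: less_Suc_eq_le[symmetric])
    then have "T x y < g + g * (L - 1)"
      unfolding T_def using group_less[of x y] by (intro add_less_le_mono mult_left_mono) auto
    also have "\<dots> = K" using L(2) by (simp add: K_def algebra_simps)
    finally show ?thesis .
  qed
  have T_eq: "pair_group g L x y' = pair_group g L z y \<and> pair_sum L x y' = pair_sum L z y"
    if "T x y' = T z y" for x y z y'
  proof -
    have "T x y' = (T z y + g * 0) mod K" using that T_less[of z y] by simp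
    note * = T_shift[OF this]
    then have "[pair_sum L x y' = pair_sum L z y] (mod L)"
      using w(1) by (simp add: cong_mult_lcancel_nat)
    then show ?thesis using * sum_less by (simp add: cong_def)
  qed
  have T_step: "pair_group g L x y' = pair_group g L z y \<and> pair_sum L x y' = (pair_sum L z y + 2) mod L"
    if "T x y' = (T z y + g * r') mod K" for x y z y'
  proof -
    note * = T_shift[OF that]
    have "[w * pair_sum L z y + r' = w * pair_sum L z y + 2 * w] (mod L)"
      using w(2) by (simp add: cong_add_lcancel_nat cong_sym)
    with * have "[w * pair_sum L x y' = w * pair_sum L z y + 2 * w] (mod L)"
      using cong_trans by blast
    then have "[w * pair_sum L x y' = w * (pair_sum L z y + 2)] (mod L)"
      by (simp only: distrib_left mult.commute[of w 2])
    then have "[pair_sum L x y' = pair_sum L z y + 2] (mod L)"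
      using w(1) cong_mult_lcancel_nat by blast
    then show ?thesis using * sum_less[of x y'] by (simp add: cong_def)
  qed
  have q_less: "q e < m" if "e \<in> edges G" for e
    using pair_pos_less[OF g L(1), of "X e" "Y e"] pair[OF that] m2 by (simp add: q_def K_def)
  have tq_inj: "e = e'" if "e \<in> edges G" "e' \<in> edges G" "t e = t e'" "q e = q e'" for e e'
  proof -
    have "X e = X e' \<and> Y e = Y e'"
      using pair_inj[OF g L(1) pair(1)[OF that(1)] _ pair(1)[OF that(2)]]
        pair(2)[OF that(1)] pair(2)[OF that(2)] T_eq[OF that(3)[unfolded t_def]] that(4)
      by (simp add: q_def K_def)
    then have "edge_pair K e = edge_pair K e'" by (simp add: X_def Y_def prod_eq_iff)
    then show ?thesis using inj_on_edge_pair that(1,2) unfolding E by (metis inj_onD)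
  qed
  have incident: "\<exists>y<K. t e = T v y \<and> q e = pair_pos g L v y \<and>
      (edge_pair K e = (v, y) \<or> edge_pair K e = (y, v))"
    if ev: "e \<in> edges G" "v \<in> e" "v < K" for e v
  proof -
    obtain y where y: "y < K" "edge_pair K e = (v, y) \<or> edge_pair K e = (y, v)"
      using edge_pair_incident[OF ev(1)[unfolded E] ev(2,3)] .
    have "T v y = T y v" by (simp only: T_def pair_commute(1)[of g L v y] pair_commute(2)[of L v y])
    with y pair_commute(3)[of g L v y] show ?thesis
      by (intro exI[of _ y]) (auto simp: t_def q_def X_def Y_def)
  qed
  \<comment> \<open>Infinity always occupies position 0, so the conditions at this vertex need no
    partner computation.\<close>
  have infinity: "X e = Y e" "q e = 0" if "e \<in> edges G" "K \<in> e" for e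
    using edge_pair_infinity[OF that(1)[unfolded E] that(2)]
    by (simp_all add: X_def Y_def q_def pair_pos_def)
  have inj: "inj_on t {e \<in> edges G. v \<in> e}" if "v \<in> verts G" for v
  proof (rule inj_onI)
    fix e e' assume e: "e \<in> {e \<in> edges G. v \<in> e}" "e' \<in> {e \<in> edges G. v \<in> e}" and eq: "t e = t e'"
    show "e = e'"
    proof (cases "v = K")
      case True
      then show ?thesis using tq_inj infinity e eq by simp
    next
      case False
      then have v: "v < K" using that by (simp add: V)
      obtain y where y: "y < K" "t e = T v y" "q e = pair_pos g L v y"
        using incident[of e v] e v by auto
      obtain y' where y': "y' < K" "t e' = T v y'" "q e' = pair_pos g L v y'"
        using incident[of e' v] e v by auto
      have "y = y'"
        using pair_inj_vertex[OF L(1), of v g y y'] v y y' T_eq[of v y v y'] eq by (simp add: K_def)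
      then show ?thesis using tq_inj e eq y y' by simp
    qed
  qed
  have step: "q e \<le> Suc (q e')"
    if st: "v \<in> verts G" "e \<in> edges G" "e' \<in> edges G" "v \<in> e" "v \<in> e'" "t e' = (t e + g * r') mod K"
    for v e e'
  proof (cases "v = K")
    case True
    then show ?thesis using infinity st by simp
  next
    case False
    then have v: "v < K" using st by (simp add: V)
    obtain y where y: "y < K" "t e = T v y" "q e = pair_pos g L v y"
      using incident[of e v] st v by auto
    obtain y' where y': "y' < K" "t e' = T v y'" "q e' = pair_pos g L v y'"
      using incident[of e' v] st v by auto
    show ?thesis
      using pair_pos_step[OF L, of v g y y'] v y y' T_step[of v y' v y] st(6) by (simp add: K_def)
  qed
  have mpos: "m > 0" using m2 by simp
  have "inj_on l (edges G)"
  proof (rule inj_onI)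
    fix e e' assume e: "e \<in> edges G" "e' \<in> edges G" and eq: "l e = l e'"
    have "t e = t e'" using arg_cong[OF eq, of "\<lambda>a. a div m"] q_less[OF e(1)] q_less[OF e(2)]
      by (simp add: l_def)
    moreover from this have "q e = q e'" using eq by (simp add: l_def)
    ultimately show "e = e'" using tq_inj e by blast
  qed
  moreover have "l ` edges G \<subseteq> {..<card (edges G)}"
  proof (rule image_subsetI)
    fix e assume "e \<in> edges G"
    then have "l e < Suc (t e) * m" using q_less by (simp add: l_def)
    also have "\<dots> \<le> K * m" using T_less by (intro mult_right_mono) (auto simp: t_def Suc_le_eq)
    finally show "l e \<in> {..<card (edges G)}" by (simp add: N)
  qed
  ultimately have ord: "edge_ordering G l"
    unfolding edge_ordering_def by (simp add: bij_betw_def card_image card_subset_eq)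
  have r: "1 \<le> g * r'" "g * r' < K" using gpos r' by (simp_all add: K_def Suc_leI)
  show ?thesis unfolding G_def[symmetric]
  proof (rule cms_geI[OF _ ord])
    show "simple_graph G" unfolding G_def by (rule simple_graph_complete_graph)
    have "g * r' * m \<le> K * m" using r by (intro mult_right_mono) auto
    then show "g * r' * m - 1 \<le> card (edges G)" unfolding N by (rule le_trans[OF diff_le_self])
    show "le_regular (g * r') (verts G, cyclic_window G l (g * r' * m - 1) i)"
      if "i < card (edges G)" for i
      using le_regular_blocks[OF N mpos l_def q_less inj step r that] .
  qed
qed

text \<open>Dividing \<open>r\<close> and \<open>n - 1\<close> by their gcd makes \<open>r'\<close>
  and \<open>L\<close> coprime. As \<open>n - 1\<close> is odd, so are \<open>g\<close> and
  \<open>L\<close>, and \<open>r < n - 1\<close> gives \<open>r' < L\<close>, hence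
  \<open>L > 1\<close>.\<close>

lemma cms_complete_graph_even:
  assumes "n \<ge> 3" "1 \<le> r" "r \<le> n - 2" "even n"
  shows "r * n \<le> 2 * cms r (complete_graph n) + 2"
proof -
  define g where "g = gcd r (n - 1)"
  define L where "L = (n - 1) div g"
  define r' where "r' = r div g"
  have gpos: "g > 0" using assms by (simp add: g_def)
  have n: "n - 1 = g * L" and r: "r = g * r'" by (simp_all add: g_def L_def r'_def)
  have Sn: "n = Suc (g * L)" using n assms(1) by simp
  have odd: "odd g" "odd L" using assms(4) Sn by auto
  have cop: "coprime r' L" unfolding r'_def L_def g_def using assms(1) by (intro div_gcd_coprime) auto
  have r'0: "r' > 0" using r assms(2) by (cases r') auto
  have "g * r' < g * L" using assms(1,3) n r by linarith
  then have r'L: "r' < L" by simp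
  have "g * r' * ((g * L + 1) div 2) - 1 \<le> cms r (complete_graph n)"
    using even_complete_graph_ordering[OF odd _ cop r'0 r'L] r'0 r'L by (simp add: Sn r)
  moreover have "2 * ((g * L + 1) div 2) = n" using odd Sn by simp
  then have "2 * (g * r' * ((g * L + 1) div 2)) = r * n" by (metis mult.left_commute r)
  ultimately show ?thesis by linarith
qed

section \<open>Odd order\<close>

text \<open>An arc leads from \<open>i\<close> to \<open>j\<close> if \<open>j - i\<close> is one of
  \<open>1, ..., r\<close> modulo \<open>2 * r + 1\<close>. This orients the complete graph with all
  in- and out-degrees equal to \<open>r\<close>, as a directed Euler circuit requires.\<close>

definition rotational_tournament :: "nat \<Rightarrow> (nat, nat \<times> nat) pre_digraph" where
  "rotational_tournament r =
    \<lparr> pre_digraph.verts = {..<2 * r + 1},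
      arcs = {(i, j). i < 2 * r + 1 \<and> j < 2 * r + 1 \<and> (i < j \<and> j \<le> i + r \<or> j + r < i)},
      tail = fst, head = snd \<rparr>"

lemma rotational_tournament_simps [simp]:
  "pre_digraph.verts (rotational_tournament r) = {..<2 * r + 1}"
  "tail (rotational_tournament r) = fst"
  "head (rotational_tournament r) = snd"
  by (simp_all add: rotational_tournament_def)

lemma arcs_rotational_tournament:
  "(i, j) \<in> arcs (rotational_tournament r) \<longleftrightarrow>
    i < 2 * r + 1 \<and> j < 2 * r + 1 \<and> (i < j \<and> j \<le> i + r \<or> j + r < i)"
  by (simp add: rotational_tournament_def)

lemma fin_digraph_rotational_tournament: "fin_digraph (rotational_tournament r)"
proof
  show "finite (arcs (rotational_tournament r))"
    by (rule finite_subset[of _ "{..<2 * r + 1} \<times> {..<2 * r + 1}"])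
      (auto simp: arcs_rotational_tournament)
qed (auto simp: arcs_rotational_tournament)

lemma out_degree_rotational_tournament:
  assumes "v < 2 * r + 1"
  shows "out_degree (rotational_tournament r) v = r"
proof -
  have "out_arcs (rotational_tournament r) v = Pair v ` ({v<..min (2 * r) (v + r)} \<union> {..<v - r})"
    using assms by (auto simp: out_arcs_def arcs_rotational_tournament image_iff)
  moreover have "card ({v<..min (2 * r) (v + r)} \<union> {..<v - r}) = r"
    using assms by (subst card_Un_disjoint) auto
  ultimately show ?thesis by (simp add: out_degree_def card_image inj_on_def)
qed

lemma in_degree_rotational_tournament:
  assumes "v < 2 * r + 1"
  shows "in_degree (rotational_tournament r) v = r"
proof -
  have "in_arcs (rotational_tournament r) v = (\<lambda>i. (i, v)) ` ({v - r..<v} \<union> {v + r<..2 * r})"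
    using assms by (auto simp: in_arcs_def arcs_rotational_tournament image_iff)
  moreover have "card ({v - r..<v} \<union> {v + r<..2 * r}) = r"
    using assms by (subst card_Un_disjoint) auto
  ultimately show ?thesis by (simp add: in_degree_def card_image inj_on_def)
qed

lemma connected_rotational_tournament: "connected (rotational_tournament r)"
proof -
  let ?G = "rotational_tournament r"
  interpret fin_digraph ?G by (rule fin_digraph_rotational_tournament)
  interpret S: pair_wf_digraph "mk_symmetric ?G" by (rule wellformed_mk_symmetric)
  have "u \<rightarrow>\<^sup>*\<^bsub>with_proj (mk_symmetric ?G)\<^esub> v" if "u < 2 * r + 1" "v < 2 * r + 1" for u v
  proof (cases "u = v")
    case True
    then show ?thesis using that by simp
  next
    case False
    then have "(u, v) \<in> arcs ?G \<or> (v, u) \<in> arcs ?G"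
      using that by (auto simp: arcs_rotational_tournament)
    then have "(u, v) \<in> parcs (mk_symmetric ?G)"
      unfolding parcs_mk_symmetric by (elim disjE) (rule UN_I, assumption, simp)+
    then show ?thesis by (simp add: S.reachable_adjI)
  qed
  then show ?thesis by (auto simp: connected_def strongly_connected_def)
qed

lemma cas_nth:
  assumes "pre_digraph.cas G u p v" "i < length p"
  shows "tail G (p ! i) = (if i = 0 then u else head G (p ! (i - 1)))
    \<and> (Suc i = length p \<longrightarrow> head G (p ! i) = v)"
  using assms
proof (induction p arbitrary: u i)
  case (Cons e es)
  then show ?case
    by (cases i; cases es) (auto simp: pre_digraph.cas.simps nth_Cons split: nat.splits)
qed simp

text \<open>The sequence \<open>c\<close> lists the tails of the arcs of a closed Euler trail in the
  tournament. A vertex occurs in it once for each arc leaving it, and forgetting directions maps the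
  arcs bijectively to the edges.\<close>

lemma euler_circuit_complete_graph:
  assumes "r \<ge> 1"
  defines "N \<equiv> (2 * r + 1) * r"
  obtains c :: "nat \<Rightarrow> nat" where
    "bij_betw (\<lambda>j. {c j, c (Suc j mod N)}) {..<N} ([{..<2 * r + 1}]\<^bsup>2\<^esup>)"
    "\<And>v. v < 2 * r + 1 \<Longrightarrow> card {j \<in> {..<N}. c j = v} = r"
proof -
  let ?G = "rotational_tournament r"
  interpret fin_digraph ?G by (rule fin_digraph_rotational_tournament)
  obtain u p where "euler_trail u p u"
    using closed_euler1[OF connected_rotational_tournament]
    by (auto simp: in_degree_rotational_tournament out_degree_rotational_tournament)
  then have p: "cas u p u" "distinct p" "set p = arcs ?G"
    by (auto simp: euler_trail_def trail_def awalk_def)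
  define f where "f = (\<lambda>a :: nat \<times> nat. {fst a, snd a})"
  have bij_f: "bij_betw f (arcs ?G) ([{..<2 * r + 1}]\<^bsup>2\<^esup>)"
  proof (rule bij_betw_imageI)
    show "inj_on f (arcs ?G)"
      by (rule inj_onI) (auto simp: f_def arcs_rotational_tournament doubleton_eq_iff)
    show "f ` arcs ?G = [{..<2 * r + 1}]\<^bsup>2\<^esup>"
    proof
      show "f ` arcs ?G \<subseteq> [{..<2 * r + 1}]\<^bsup>2\<^esup>"
        by (auto simp: f_def arcs_rotational_tournament nsets_def)
      show "[{..<2 * r + 1}]\<^bsup>2\<^esup> \<subseteq> f ` arcs ?G"
      proof
        fix e assume "e \<in> [{..<2 * r + 1}]\<^bsup>2\<^esup>"
        then obtain x y where xy: "e = {x, y}" "x \<noteq> y" "x < 2 * r + 1" "y < 2 * r + 1"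
          by (auto simp: nsets_2_eq)
        then have "(x, y) \<in> arcs ?G \<or> (y, x) \<in> arcs ?G" by (auto simp: arcs_rotational_tournament)
        then show "e \<in> f ` arcs ?G"
          using xy(1) by (force simp: f_def insert_commute)
      qed
    qed
  qed
  have len: "length p = N"
  proof -
    have "length p = card (arcs ?G)" using p by (metis distinct_card)
    also have "\<dots> = (2 * r + 1) choose 2" using bij_betw_same_card[OF bij_f] by simp
    also have "\<dots> = N" by (simp add: choose_two N_def)
    finally show ?thesis .
  qed
  have bij_p: "bij_betw (nth p) {..<N} (arcs ?G)"
    using bij_betw_nth[OF p(2) _ p(3)[symmetric]] len by simp
  define c where "c = (\<lambda>j. fst (p ! j))"
  have Npos: "N > 0" using assms(1) by (simp add: N_def)
  \<comment> \<open>For the last arc this uses that the trail is closed: its head is the tail of the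
    first arc.\<close>
  have next_eq: "snd (p ! j) = c (Suc j mod N)" if "j < N" for j
  proof (cases "Suc j = N")
    case True
    then show ?thesis
      using cas_nth[OF p(1), of j] cas_nth[OF p(1), of 0] len Npos by (simp add: c_def)
  next
    case False
    then show ?thesis using cas_nth[OF p(1), of "Suc j"] len that by (simp add: c_def)
  qed
  show ?thesis
  proof
    have "bij_betw (f \<circ> nth p) {..<N} ([{..<2 * r + 1}]\<^bsup>2\<^esup>)"
      using bij_betw_trans[OF bij_p bij_f] .
    then show "bij_betw (\<lambda>j. {c j, c (Suc j mod N)}) {..<N} ([{..<2 * r + 1}]\<^bsup>2\<^esup>)"
      by (rule bij_betw_cong[THEN iffD1, rotated]) (simp add: f_def c_def next_eq[unfolded c_def])
    fix v assume v: "v < 2 * r + 1"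
    have "bij_betw (nth p) {j \<in> {..<N}. c j = v} (out_arcs ?G v)"
      using bij_p unfolding bij_betw_def
      by (auto simp: c_def out_arcs_def inj_on_def image_iff) (metis fst_conv imageE lessThan_iff)
    then show "card {j \<in> {..<N}. c j = v} = r"
      using out_degree_rotational_tournament[OF v] bij_betw_same_card
      by (fastforce simp: out_degree_def)
  qed
qed

section \<open>Separating cyclically consecutive indices\<close>

text \<open>The assumptions put \<open>x\<close> and \<open>y\<close> at cyclic distance at least
  \<open>s\<close>, while two labels in a window of length \<open>s\<close> are closer than
  that.\<close>

lemma not_in_common_window:
  fixes x y s N :: nat
  assumes "x < N" "x \<le> y" "s \<le> y - x" "y - x + s \<le> N" "a < s" "b < s"
    and "x = (i + a) mod N" "y = (i + b) mod N"
  shows False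
proof -
  define d where "d = y - x"
  have "[i + b = x + d] (mod N)" using assms(2,8) by (simp add: cong_def d_def)
  moreover have "[x + d = i + a + d] (mod N)" using assms(7) by (simp add: cong_def mod_add_left_eq)
  ultimately have "[i + b = i + (a + d)] (mod N)" using cong_trans by (metis add.assoc)
  then have "[b = a + d] (mod N)" by (simp only: cong_add_lcancel_nat)
  moreover have "a + d < N" "b < N" using assms(4,5,6) unfolding d_def[symmetric] by linarith+
  ultimately show False using assms(3,6) by (simp add: cong_def d_def[symmetric])
qed

lemma bij_betw_if_inj_on:
  assumes "inj_on P {..<N :: nat}" "\<And>j. j < N \<Longrightarrow> P j < N"
  shows "bij_betw P {..<N} {..<N}"
  using assms endo_inj_surj[of "{..<N}" P] by (auto simp: bij_betw_def)

text \<open>Here \<open>N = 2 * s + 1\<close>. Multiplication by \<open>s\<close>, which is coprime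
  to \<open>N\<close>, sends consecutive indices to positions differing by \<open>s\<close> or
  \<open>s + 1\<close>, and both differences lie between \<open>s\<close> and
  \<open>N - s\<close>.\<close>

lemma separating_positions_odd:
  assumes "odd N" "N \<ge> 3"
  defines "s \<equiv> (N - 1) div 2"
  obtains P where "bij_betw P {..<N} {..<N}"
    "\<And>i j a b. j < N \<Longrightarrow> a < s \<Longrightarrow> b < s \<Longrightarrow> P j = (i + a) mod N \<Longrightarrow>
      P (Suc j mod N) = (i + b) mod N \<Longrightarrow> False"
proof -
  define P where "P = (\<lambda>j. j * s mod N)"
  have N: "N = 2 * s + 1" using assms(1,2) by (simp add: s_def)
  have "coprime s N" unfolding N
    by (rule coprimeI) (metis dvd_add_right_iff dvd_mult)
  then have bij: "bij_betw P {..<N} {..<N}"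
    using N by (intro bij_betw_if_inj_on inj_onI) (auto simp: P_def cong_mult_rcancel_nat simp flip: cong_def,
      simp add: cong_def)
  show ?thesis
  proof (rule that[OF bij])
    fix i j a b assume j: "j < N" and ab: "a < s" "b < s"
      and x: "P j = (i + a) mod N" and y: "P (Suc j mod N) = (i + b) mod N"
    have "P (Suc j mod N) = (j * s + s) mod N"
      by (simp add: P_def mod_mult_left_eq add.commute)
    then have Py: "P (Suc j mod N) = (P j + s) mod N" by (simp add: P_def mod_add_left_eq)
    have lt: "P j < N" using N by (simp add: P_def)
    show False
    proof (cases "P j + s < N")
      case True
      then show ?thesis
        using not_in_common_window[OF lt _ _ _ ab x y] Py N by simp
    next
      case False
      then have "P (Suc j mod N) = P j + s - N" using Py lt N by (simp add: le_mod_geq)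
      then show ?thesis
        using False lt N by (intro not_in_common_window[OF _ _ _ _ ab(2,1) y x]) linarith+
    qed
  qed
qed

text \<open>With \<open>N = 2M\<close>, think of the positions as two rows of \<open>M\<close>. The circuit zigzags between the rows
  from left to right and returns through the remaining cells.\<close>

lemma separating_positions_even:
  assumes "even N" "N > 0"
  defines "s \<equiv> (N - 1) div 2"
  obtains P where "bij_betw P {..<N} {..<N}"
    "\<And>i j a b. j < N \<Longrightarrow> a < s \<Longrightarrow> b < s \<Longrightarrow> P j = (i + a) mod N \<Longrightarrow>
      P (Suc j mod N) = (i + b) mod N \<Longrightarrow> False"
proof -
  define M where "M = N div 2"
  have N: "N = 2 * M" and s: "s = M - 1" and M: "M > 0"
    using assms(1,2) by (auto simp: M_def s_def)
  define x where "x j = (if j < M then j else N - 1 - j)" for j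
  define \<rho> where "\<rho> j = (if j < M then j mod 2 else 1 - x j mod 2)" for j
  define P where "P j = \<rho> j * M + x j" for j
  have x: "x j < M" and \<rho>: "\<rho> j < 2" if "j < N" for j
    using that N by (auto simp: x_def \<rho>_def)
  have "inj_on P {..<N}"
  proof (rule inj_onI)
    fix j j' assume j: "j \<in> {..<N}" "j' \<in> {..<N}" and eq: "P j = P j'"
    have xe: "x j = x j'"
      using arg_cong[OF eq, of "\<lambda>a. a mod M"] x j by (simp add: P_def)
    then have "\<rho> j = \<rho> j'" using eq M by (simp add: P_def)
    \<comment> \<open>The row equals the parity of the column exactly on the way out, so a cell
      reveals the direction of travel.\<close>
    moreover have "a mod 2 \<noteq> 1 - a mod 2" for a :: nat by presburger
    moreover have "\<rho> k = (if k < M then x k mod 2 else 1 - x k mod 2)" for k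
      by (simp add: \<rho>_def x_def)
    ultimately have "j < M \<longleftrightarrow> j' < M" using xe by metis
    then show "j = j'"
      using xe j by (simp add: x_def split: if_splits)
  qed
  moreover have "P j < N" if "j < N" for j
    using x[OF that] \<rho>[OF that] less_2_cases[of "\<rho> j"] by (auto simp: P_def N)
  ultimately have bij: "bij_betw P {..<N} {..<N}" by (rule bij_betw_if_inj_on)
  \<comment> \<open>Each move changes the row and shifts the column by at most 1, not at all at the
    two turning points. The positions thus differ by \<open>M - 1\<close>, \<open>M\<close> or
    \<open>M + 1\<close>, that is, by at least \<open>s\<close> and at most
    \<open>N - s\<close>.\<close>
  have near: "\<rho> j + \<rho> (Suc j mod N) = 1 \<and> x j \<le> Suc (x (Suc j mod N)) \<and> x (Suc j mod N) \<le> Suc (x j)"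
    if jN: "j < N" for j
  proof -
    consider "Suc j < M" | "Suc j = M" | "M \<le> j" "Suc j < N" | "Suc j = N" using jN by linarith
    then show ?thesis
    proof cases
      case 1
      then have "Suc j mod N = Suc j" using N by simp
      then show ?thesis using 1 by (simp add: \<rho>_def x_def mod_Suc)
    next
      case 2
      then have "Suc j mod N = Suc j" "N - 1 - Suc j = j" using N M by auto
      then show ?thesis using 2 by (simp add: \<rho>_def x_def)
    next
      case 3
      then have "Suc j mod N = Suc j" "N - 1 - j = Suc (N - 1 - Suc j)" by auto
      then show ?thesis using 3 by (simp add: \<rho>_def x_def mod_Suc)
    next
      case 4
      then show ?thesis using N M by (simp add: \<rho>_def x_def)
    qed
  qed
  show ?thesis
  proof (rule that[OF bij])
    fix i j a b assume j: "j < N" and ab: "a < s" "b < s"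
      and px: "P j = (i + a) mod N" and py: "P (Suc j mod N) = (i + b) mod N"
    let ?j = "Suc j mod N"
    have j': "?j < N" using j by simp
    have "\<rho> j = 0 \<and> \<rho> ?j = 1 \<or> \<rho> j = 1 \<and> \<rho> ?j = 0" using near[OF j] by linarith
    then show False
    proof
      assume "\<rho> j = 0 \<and> \<rho> ?j = 1"
      then have "P j = x j" "P ?j = M + x ?j" by (simp_all add: P_def)
      then show False
        using near[OF j] x[OF j] x[OF j'] N s
        by (intro not_in_common_window[OF _ _ _ _ ab px py]) linarith+
    next
      assume "\<rho> j = 1 \<and> \<rho> ?j = 0"
      then have "P j = M + x j" "P ?j = x ?j" by (simp_all add: P_def)
      then show False
        using near[OF j] x[OF j] x[OF j'] N s
        by (intro not_in_common_window[OF _ _ _ _ ab(2,1) py px]) linarith+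
    qed
  qed
qed

text \<open>Edge number \<open>j\<close> of the circuit receives the label \<open>P j\<close>.
  Within a window, each edge at \<open>v\<close> is charged to one of the \<open>r\<close> visits of
  the circuit to \<open>v\<close>, and no visit is charged twice.\<close>

lemma cms_complete_graph_odd:
  assumes "r \<ge> 1"
  defines "N \<equiv> (2 * r + 1) * r"
  shows "(N - 1) div 2 \<le> cms r (complete_graph (2 * r + 1))"
proof -
  define G where "G = complete_graph (2 * r + 1)"
  have E: "edges G = [{..<2 * r + 1}]\<^bsup>2\<^esup>" and V: "fst G = {..<2 * r + 1}"
    by (simp_all add: G_def complete_graph_def)
  have "3 * 1 \<le> N" unfolding N_def using assms(1) by (intro mult_le_mono) auto
  then have N3: "N \<ge> 3" by simp
  obtain c where bij: "bij_betw (\<lambda>j. {c j, c (Suc j mod N)}) {..<N} (edges G)"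
    and cnt: "\<And>v. v < 2 * r + 1 \<Longrightarrow> card {j \<in> {..<N}. c j = v} = r"
    using euler_circuit_complete_graph[OF assms(1)] unfolding E N_def by blast
  define s where "s = (N - 1) div 2"
  obtain P where P: "bij_betw P {..<N} {..<N}"
    and sep: "\<And>i j a b. j < N \<Longrightarrow> a < s \<Longrightarrow> b < s \<Longrightarrow> P j = (i + a) mod N \<Longrightarrow>
      P (Suc j mod N) = (i + b) mod N \<Longrightarrow> False"
  proof (cases "even N")
    case True
    show thesis using separating_positions_even[OF True] N3 that unfolding s_def by auto
  next
    case False
    show thesis using separating_positions_odd[OF False N3] that unfolding s_def by blast
  qed
  define F where "F = (\<lambda>j. {c j, c (Suc j mod N)})"
  define J where "J = the_inv_into {..<N} F"
  have bij_F: "bij_betw F {..<N} (edges G)" using bij by (simp add: F_def)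
  have bij_J: "bij_betw J (edges G) {..<N}" unfolding J_def by (rule bij_betw_the_inv_into[OF bij_F])
  have FJ: "F (J e) = e" if "e \<in> edges G" for e
    unfolding J_def using f_the_inv_into_f_bij_betw[OF bij_F] that by blast
  have J_less: "J e < N" if "e \<in> edges G" for e
    using bij_betwE[OF bij_J] that by auto
  have card_E: "card (edges G) = N" using bij_betw_same_card[OF bij_F] by simp
  define l where "l = P \<circ> J"
  have ord: "edge_ordering G l"
    unfolding edge_ordering_def card_E l_def by (rule bij_betw_trans[OF bij_J P])
  show ?thesis unfolding G_def[symmetric] s_def[symmetric]
  proof (rule cms_geI[OF _ ord])
    show "simple_graph G" unfolding G_def by (rule simple_graph_complete_graph)
    show "s \<le> card (edges G)" by (simp add: card_E s_def)
    fix i assume "i < card (edges G)"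
    show "le_regular r (fst G, cyclic_window G l s i)"
      unfolding le_regular_def degree_def fst_conv snd_conv
    proof
      fix v assume v: "v \<in> fst G"
      define A where "A = {e \<in> cyclic_window G l s i. v \<in> e}"
      \<comment> \<open>The visit charged by \<open>e\<close>: the index at which the end
        \<open>v\<close> of \<open>e\<close> occurs in the circuit.\<close>
      define h where "h e = (if c (J e) = v then J e else Suc (J e) mod N)" for e
      have A: "e \<in> edges G" "c (h e) = v" "h e < N" "\<exists>a<s. P (J e) = (i + a) mod N" if "e \<in> A" for e
      proof -
        show e: "e \<in> edges G" using that by (simp add: A_def cyclic_window_def)
        have "v \<in> F (J e)" using FJ[OF e] that by (simp add: A_def)
        then show "c (h e) = v" by (auto simp: h_def F_def)
        show "h e < N" using J_less[OF e] by (simp add: h_def)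
        show "\<exists>a<s. P (J e) = (i + a) mod N"
          using that by (simp add: A_def cyclic_window_def l_def card_E)
      qed
      have "inj_on h A"
      proof (rule inj_onI)
        fix e e' assume e: "e \<in> A" "e' \<in> A" and eq: "h e = h e'"
        have no: False if "f \<in> A" "f' \<in> A" "J f' = Suc (J f) mod N" for f f'
          using A(4)[OF that(1)] A(4)[OF that(2)] sep[OF J_less[OF A(1)[OF that(1)]]] that(3) by metis
        \<comment> \<open>Distinct edges charging the same visit would be the ones entering and
          leaving \<open>v\<close> there, hence neighbours on the circuit, which \<open>no\<close>
          excludes.\<close>
        have suc: "j = k" if "Suc j mod N = Suc k mod N" "j < N" "k < N" for j k
          using that by (auto simp: mod_Suc split: if_splits)
        have "J e = J e'"
          using eq no[of e e'] no[of e' e] e suc J_less[OF A(1)[OF e(1)]] J_less[OF A(1)[OF e(2)]]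
          unfolding h_def by (metis (full_types))
        then show "e = e'" using FJ A(1) e by metis
      qed
      moreover have "h ` A \<subseteq> {j \<in> {..<N}. c j = v}" using A(2,3) by auto
      ultimately have "card A \<le> card {j \<in> {..<N}. c j = v}"
        by (intro card_inj_on_le) auto
      then show "card {e \<in> cyclic_window G l s i. v \<in> e} \<le> r"
        using cnt v by (simp add: A_def V)
    qed
  qed
qed

theorem theorem5:
  fixes n r :: nat
  assumes "n \<ge> 3" and "1 \<le> r" and "r \<le> n - 2"
    and "even n \<or> (odd n \<and> real r = (real n - 1) / 2)"
  shows "int (cms r (complete_graph n)) = \<lfloor>(real r * real n - 1) / 2\<rfloor>"
proof -
  define s where "s = cms r (complete_graph n)"
  have upper: "2 * s < r * n"
    unfolding s_def by (rule cms_complete_graph_le[OF assms(1-3)])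
  have lower: "r * n \<le> 2 * s + 2"
  proof (cases "even n")
    case True
    then show ?thesis unfolding s_def by (rule cms_complete_graph_even[OF assms(1-3)])
  next
    case False
    then have "real n = real (2 * r + 1)" using assms(4) by simp
    then have n: "n = 2 * r + 1" by (simp only: of_nat_eq_iff)
    have "(n * r - 1) div 2 \<le> s"
      using cms_complete_graph_odd[OF assms(2)] unfolding s_def n .
    then show ?thesis using upper by (simp add: mult.commute)
  qed
  \<comment> \<open>The bounds \<open>2 * s + 1 \<le> r * n \<le> 2 * s + 2\<close> place
    \<open>(r * n - 1) / 2\<close> between \<open>s\<close> and \<open>s + 1/2\<close>.\<close>
  have "real (r * n) \<le> real (2 * s + 2)" "real (2 * s + 1) \<le> real (r * n)"
    using lower upper by (simp_all only: of_nat_le_iff)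
  then have "\<lfloor>(real r * real n - 1) / 2\<rfloor> = int s"
    by (intro floor_unique) simp_all
  then show ?thesis by (simp add: s_def)
qed

end
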